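(* For any integer $n\ge 0$, we have $$DSOME(n)\equiv \begin{cases} 1\pmod 2, & \text{if } n=24j^2+10j+1 \text{ or } n=24j^2+22j+5 \text{ for some } j\in\mathbb Z,\\ 0\pmod 2, & \text{otherwise}. \end{cases}$$
   Context: $DSOME(n)$ denotes the sum of all the odd parts in all the partitions of $n$ into distinct parts minus the sum of all the even parts in all those same partitions, with $DSOME(0)=0$. Equivalently, $\sum_{n\ge 0}DSOME(n)q^n=\prod_{j\ge1}(1+q^j)\cdot\sum_{m\ge 1}\frac{(-1)^{m-1}q^m}{(1+q^m)^2}$. *)

theory Defs
  imports Complex_Main "HOL-Number_Theory.Cong"
begin

(* A partition into distinct parts is determined by its set of parts. *)
definition distinct_partitions :: "nat \<Rightarrow> nat set set" where
  "distinct_partitions n = {P. finite P \<and> (\<forall>p\<in>P. p > 0) \<and> \<Sum>P = n}"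

(* Sums over infinite sets are 0 by convention, so finiteness matters for DSOME. *)
lemma finite_distinct_partitions: "finite (distinct_partitions n)"
proof (rule finite_subset)
  show "distinct_partitions n \<subseteq> Pow {..n}"
    by (auto simp: distinct_partitions_def intro: member_le_sum[where f = "\<lambda>x. x"])
qed simp

definition DSOME :: "nat \<Rightarrow> int" where
  "DSOME n =
     (\<Sum>P\<in>distinct_partitions n. \<Sum>p\<in>{p\<in>P. odd p}. int p) -
     (\<Sum>P\<in>distinct_partitions n. \<Sum>p\<in>{p\<in>P. even p}. int p)"

lemma DSOME_0: "DSOME 0 = 0"
proof -
  have "distinct_partitions 0 = {{}}"
    by (force simp: distinct_partitions_def)
  then show ?thesis
    by (simp add: DSOME_def)
qed

end

theory Submission
  imports Defs "HOL-Computational_Algebra.Formal_Power_Series" "HOL-Library.Nat_Bijection"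
begin

text \<open>
  Modulo 2 the sign in front of the even parts does not matter, so every partition of \<open>n\<close> into
  distinct parts contributes \<open>n\<close> to the sum (\<open>DSOME_cong\<close>). Hence \<open>DSOME n\<close> has the parity of
  \<open>n * Q n\<close>, where \<open>Q n\<close> is the number of partitions of \<open>n\<close> into distinct parts.

  The generating function of \<open>Q\<close> is \<open>\<Prod>k. 1 + q ^ k\<close>, which has the same coefficients modulo 2 as
  Euler's product \<open>\<Prod>k. 1 - q ^ k\<close>. By the pentagonal number theorem, these are odd precisely at
  the generalized pentagonal numbers \<open>k * (3 * k - 1) / 2\<close> with \<open>k\<close> an integer, so the same holds
  for \<open>Q\<close> (\<open>card_distinct_partitions_cong\<close>). The pentagonal number theorem itself comes from an
  identity between finite sums due to Shanks (\<open>shanks_identity\<close>): it holds in every commutative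
  ring by telescoping, and for \<open>x = q\<close> it agrees with Euler's theorem up to \<open>q ^ n\<close>.

  Therefore \<open>DSOME n\<close> is odd exactly when \<open>n\<close> is an odd generalized pentagonal number. Oddness
  singles out the indices \<open>k\<close> congruent to 1 or 2 modulo 4, and these give the two quadratic
  families of the theorem (\<open>odd_pentagonal_iff\<close>).
\<close>

section \<open>The pentagonal numbers\<close>

text \<open>
  The index ranges over all integers: \<open>k > 0\<close> gives 1, 5, 12, \<open>\<dots>\<close> and \<open>k < 0\<close> gives
  2, 7, 15, \<open>\<dots>\<close>, so that both exponents of Euler's theorem come from one formula.
\<close>
definition pentagonal :: "int \<Rightarrow> nat" where
  "pentagonal k = nat (k * (3 * k - 1) div 2)"

lemma double_pentagonal: "2 * int (pentagonal k) = k * (3 * k - 1)"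
proof -
  have "even (k * (3 * k - 1))"
    by simp
  moreover have "0 \<le> k * (3 * k - 1)"
    by (cases "k \<le> 0") (auto simp: zero_le_mult_iff)
  ultimately show ?thesis
    by (simp add: pentagonal_def)
qed

lemma pentagonal_eq_iff: "pentagonal k = n \<longleftrightarrow> 2 * int n = k * (3 * k - 1)"
  using double_pentagonal[of k] by auto

text \<open>
  Injectivity prevents two terms of the pentagonal series from meeting in one coefficient, where
  they could cancel. It holds because \<open>k * (3 * k - 1) - l * (3 * l - 1)\<close> factors as
  \<open>(k - l) * (3 * (k + l) - 1)\<close>, and the second factor is nonzero modulo 3.
\<close>
lemma inj_pentagonal: "inj pentagonal"
proof (rule injI)
  fix k l :: int
  assume "pentagonal k = pentagonal l"
  then have "k * (3 * k - 1) = l * (3 * l - 1)"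
    using double_pentagonal by metis
  then have "(k - l) * (3 * (k + l) - 1) = 0"
    by (simp add: algebra_simps)
  moreover have "3 * (k + l) - 1 \<noteq> 0"
    by presburger
  ultimately show "k = l"
    by simp
qed

text \<open>
  This bound ensures that a representation of \<open>n\<close> as a pentagonal number has its index among
  \<open>-n, \<dots>, n\<close>, the range of the finite sum in Shanks' identity.
\<close>
lemma abs_le_pentagonal: "\<bar>k\<bar> \<le> int (pentagonal k)"
proof -
  have "2 * \<bar>k\<bar> \<le> k * (3 * k - 1)"
  proof (cases "k \<le> 0")
    case True
    then have "0 \<le> k * (3 * k + 1)"
      by (cases "k = 0") (auto simp: zero_le_mult_iff)
    with True show ?thesis
      by (simp add: algebra_simps)
  next
    case False
    then have "k * 2 \<le> k * (3 * k - 1)"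
      by (intro mult_left_mono) auto
    with False show ?thesis
      by simp
  qed
  then show ?thesis
    using double_pentagonal[of k] by linarith
qed

text \<open>
  The parity of \<open>k * (3 * k - 1) / 2\<close> depends only on \<open>k\<close> modulo 4. It is odd for
  \<open>k = 4 * j + 1\<close>, with value \<open>(4 * j + 1) * (6 * j + 1)\<close>, and for \<open>k = 4 * j + 2\<close>, with value
  \<open>(2 * j + 1) * (12 * j + 5)\<close>; in the other two classes a factor 2 survives the halving.
\<close>
lemma odd_pentagonal_iff:
  "(\<exists>j. int n = 24 * j\<^sup>2 + 10 * j + 1 \<or> int n = 24 * j\<^sup>2 + 22 * j + 5) \<longleftrightarrow>
   odd n \<and> n \<in> range pentagonal" (is "?L \<longleftrightarrow> ?R")
proof
  assume ?L
  then obtain j where j: "int n = 24 * j\<^sup>2 + 10 * j + 1 \<or> int n = 24 * j\<^sup>2 + 22 * j + 5"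
    by blast
  moreover have "odd (24 * j\<^sup>2 + 10 * j + 1)" "odd (24 * j\<^sup>2 + 22 * j + 5)"
    by simp_all
  ultimately have "odd (int n)"
    by metis
  moreover from j have "pentagonal (4 * j + 1) = n \<or> pentagonal (4 * j + 2) = n"
  proof (rule disj_forward)
    show "pentagonal (4 * j + 1) = n" if "int n = 24 * j\<^sup>2 + 10 * j + 1"
      unfolding pentagonal_eq_iff that by (simp add: power2_eq_square algebra_simps)
    show "pentagonal (4 * j + 2) = n" if "int n = 24 * j\<^sup>2 + 22 * j + 5"
      unfolding pentagonal_eq_iff that by (simp add: power2_eq_square algebra_simps)
  qed
  ultimately show ?R
    by auto
next
  assume ?R
  then obtain k where "odd (int n)" and k: "2 * int n = k * (3 * k - 1)"
    using double_pentagonal by auto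
  define j where "j = k div 4"
  have "k = 4 * j \<or> k = 4 * j + 1 \<or> k = 4 * j + 2 \<or> k = 4 * j + 3"
    unfolding j_def by presburger
  then show ?L
  proof (elim disjE)
    assume "k = 4 * j"
    with k have "int n = 2 * (j * (12 * j - 1))"
      by (simp add: algebra_simps)
    with \<open>odd (int n)\<close> show ?L
      by simp
  next
    assume "k = 4 * j + 1"
    with k have "int n = 24 * j\<^sup>2 + 10 * j + 1"
      by (simp add: algebra_simps power2_eq_square)
    then show ?L
      by blast
  next
    assume "k = 4 * j + 2"
    with k have "int n = 24 * j\<^sup>2 + 22 * j + 5"
      by (simp add: algebra_simps power2_eq_square)
    then show ?L
      by blast
  next
    assume "k = 4 * j + 3"
    with k have "int n = 2 * ((4 * j + 3) * (3 * j + 2))"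
      by (simp add: algebra_simps)
    with \<open>odd (int n)\<close> show ?L
      by simp
  qed
qed

section \<open>Shanks' finite form of the pentagonal number theorem\<close>

text \<open>
  The product over \<open>{s<..n}\<close> is the quotient of the partial Euler products up to \<open>n\<close> and up to
  \<open>s\<close>, written without division so that it makes sense in any commutative ring. The term at
  \<open>s = 0\<close> is the full partial product, and every other term has a factor \<open>x\<close> to a power larger
  than \<open>n\<close>.
\<close>
definition shanks_term :: "'a::comm_ring_1 \<Rightarrow> nat \<Rightarrow> nat \<Rightarrow> 'a" where
  "shanks_term x n s = (-1) ^ s * (\<Prod>k\<in>{s<..n}. 1 - x ^ k) * x ^ (s * n + triangle s)"

text \<open>
  Passing from \<open>n\<close> to \<open>n + 1\<close> multiplies the \<open>s\<close>-th term by \<open>(1 - x ^ (n + 1)) * x ^ s\<close>. The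
  change is therefore the old term times \<open>- (1 - x ^ s) - x ^ (n + 1 + s)\<close>. In its first half, the
  factor \<open>1 - x ^ s\<close> extends the product over \<open>{s<..n}\<close> to \<open>{s - 1<..n}\<close>, so this half cancels the
  second half of the change at \<open>s - 1\<close>. Only the second half at \<open>s = m\<close> is left over.
\<close>
lemma sum_shanks_term_diff:
  fixes x :: "'a::comm_ring_1"
  assumes "m \<le> n"
  shows "(\<Sum>s\<le>m. shanks_term x (Suc n) s - shanks_term x n s) =
    (-1) ^ Suc m * (\<Prod>k\<in>{m<..n}. 1 - x ^ k) * x ^ (Suc m * n + triangle (Suc m))"
  using assms
proof (induction m)
  case 0
  have "{0<..Suc n} = insert (Suc n) {0<..n}"
    by auto
  then show ?case
    by (simp add: shanks_term_def algebra_simps)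
next
  case (Suc m)
  have 1: "{Suc m<..Suc n} = insert (Suc n) {Suc m<..n}" and 2: "{m<..n} = insert (Suc m) {Suc m<..n}"
    using Suc.prems by auto
  define p where "p = (\<Prod>k\<in>{Suc m<..n}. 1 - x ^ k)"
  define e where "e = Suc m * n + triangle (Suc m)"
  have 3: "(\<Prod>k\<in>{Suc m<..Suc n}. 1 - x ^ k) = (1 - x ^ Suc n) * p"
    unfolding 1 p_def by (subst prod.insert) auto
  have 4: "(\<Prod>k\<in>{m<..n}. 1 - x ^ k) = (1 - x ^ Suc m) * p"
    unfolding 2 p_def by (subst prod.insert) auto
  have e1: "Suc m * Suc n + triangle (Suc m) = e + Suc m"
    and e2: "Suc (Suc m) * n + triangle (Suc (Suc m)) = e + Suc m + Suc n"
    by (simp_all add: e_def)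
  have "(\<Sum>s\<le>Suc m. shanks_term x (Suc n) s - shanks_term x n s) =
    (-1) ^ Suc m * ((1 - x ^ Suc m) * p) * x ^ e
      + ((-1) ^ Suc m * ((1 - x ^ Suc n) * p) * x ^ (e + Suc m) - (-1) ^ Suc m * p * x ^ e)"
    using Suc.IH Suc.prems
    unfolding sum.atMost_Suc shanks_term_def 3 4 e1 unfolding p_def e_def by simp
  also have "\<dots> = (-1) ^ Suc (Suc m) * p * x ^ (e + Suc m + Suc n)"
    unfolding power_add power_Suc[of "-1" "Suc m"] by (simp only: algebra_simps) simp
  finally show ?case
    unfolding e2 p_def .
qed

text \<open>
  When \<open>n\<close> grows to \<open>n + 1\<close>, the left-hand side gains two monomials: the remainder of the
  telescoping sum over \<open>s \<le> n\<close>, and the new term at \<open>s = n + 1\<close>, whose product is empty. Their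
  exponents are the pentagonal numbers with index \<open>n + 1\<close> and \<open>- (n + 1)\<close>, which are exactly the
  two indices that the right-hand side gains.
\<close>
lemma shanks_identity:
  fixes x :: "'a::comm_ring_1"
  shows "(\<Sum>s\<le>n. shanks_term x n s) =
    (\<Sum>k\<in>{- int n..int n}. (-1) ^ nat \<bar>k\<bar> * x ^ pentagonal k)"
proof (induction n)
  case 0
  show ?case
    by (simp add: shanks_term_def pentagonal_def)
next
  case (Suc n)
  have dt: "2 * triangle k = k * Suc k" for k
    unfolding triangle_def by simp
  have tri: "2 * int (triangle (Suc n)) = (int n + 1) * (int n + 2)"
    using arg_cong[OF dt[of "Suc n"], of int] by (simp add: algebra_simps)
  have e1: "pentagonal (int (Suc n)) = Suc n * n + triangle (Suc n)"
    and e2: "pentagonal (- int (Suc n)) = Suc n * Suc n + triangle (Suc n)"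
    unfolding pentagonal_eq_iff of_nat_add distrib_left tri
    by (simp_all add: algebra_simps del: triangle_Suc)
  have ivl: "{- int (Suc n)..int (Suc n)} = insert (int (Suc n)) (insert (- int (Suc n)) {- int n..int n})"
    by auto
  have last: "shanks_term x (Suc n) (Suc n) = (-1) ^ Suc n * x ^ (Suc n * Suc n + triangle (Suc n))"
    and first: "(\<Prod>k\<in>{n<..n}. 1 - x ^ k) = 1" "1 * y = y" "y * 1 = y" for y :: 'a
    by (simp_all add: shanks_term_def)
  have "(\<Sum>s\<le>Suc n. shanks_term x (Suc n) s) =
    (\<Sum>s\<le>n. shanks_term x n s) + (\<Sum>s\<le>n. shanks_term x (Suc n) s - shanks_term x n s)
      + shanks_term x (Suc n) (Suc n)"
    by (simp add: sum_subtractf)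
  also have "\<dots> = (\<Sum>k\<in>{- int n..int n}. (-1) ^ nat \<bar>k\<bar> * x ^ pentagonal k)
      + (-1) ^ Suc n * x ^ pentagonal (int (Suc n)) + (-1) ^ Suc n * x ^ pentagonal (- int (Suc n))"
    unfolding Suc.IH sum_shanks_term_diff[OF order_refl] e1 e2 by (simp only: last first)
  also have "\<dots> = (\<Sum>k\<in>{- int (Suc n)..int (Suc n)}. (-1) ^ nat \<bar>k\<bar> * x ^ pentagonal k)"
  proof -
    have a: "nat \<bar>int (Suc n)\<bar> = Suc n" "nat \<bar>- int (Suc n)\<bar> = Suc n"
      by simp_all
    have b: "int (Suc n) \<notin> insert (- int (Suc n)) {- int n..int n}" "- int (Suc n) \<notin> {- int n..int n}"
      by auto
    show ?thesis
      unfolding ivl sum.insert[OF finite.insertI[OF finite_atLeastAtMost_int] b(1)]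
        sum.insert[OF finite_atLeastAtMost_int b(2)] a
      by (simp only: ac_simps)
  qed
  finally show ?case .
qed

section \<open>Counting partitions into distinct parts modulo 2\<close>

lemma fps_nth_signed_power:
  "fps_nth ((-1) ^ a * fps_X ^ m) n = ((-1) ^ a * (if m = n then 1 else 0) :: int)"
  by (cases "even a") (auto simp: fps_X_power_iff)

text \<open>
  Expanding the product over all subsets \<open>B\<close> of \<open>{0<..n}\<close>, the coefficient of \<open>q ^ n\<close> counts those
  with sum \<open>n\<close>, each with the sign \<open>(-1) ^ card B\<close>, which is 1 modulo 2. These are
  all the partitions of \<open>n\<close> into distinct parts, since no part exceeds \<open>n\<close>.
\<close>
lemma euler_product_coefficient_cong:
  "[fps_nth (\<Prod>k\<in>{0<..n}. 1 - fps_X ^ k) n = int (card (distinct_partitions n))] (mod 2)"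
proof -
  have "(\<Prod>k\<in>{0<..n}. 1 - fps_X ^ k :: int fps) =
    (\<Sum>B\<in>Pow {0<..n}. (-1) ^ card B * fps_X ^ \<Sum>B)"
    by (simp add: prod_diff_conv_sum power_sum)
  then have "fps_nth (\<Prod>k\<in>{0<..n}. 1 - fps_X ^ k) n =
    (\<Sum>B\<in>Pow {0<..n}. (-1) ^ card B * (if \<Sum>B = n then 1 else 0) :: int)"
    by (simp only: fps_sum_nth fps_nth_signed_power)
  also have "[\<dots> = (\<Sum>B\<in>Pow {0<..n}. if \<Sum>B = n then 1 else 0)] (mod 2)"
    by (intro cong_sum) (auto simp: cong_iff_dvd_diff)
  also have "(\<Sum>B\<in>Pow {0<..n}. if \<Sum>B = n then 1 else 0) = int (card {B \<in> Pow {0<..n}. \<Sum>B = n})"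
    by (simp add: sum.If_cases Int_def)
  also have "{B \<in> Pow {0<..n}. \<Sum>B = n} = distinct_partitions n"
    by (auto simp: distinct_partitions_def intro: finite_subset member_le_sum[where f = "\<lambda>x. x"])
  finally show ?thesis .
qed

text \<open>
  Shanks' identity for \<open>x = q\<close> is compared at the coefficient of \<open>q ^ n\<close>. On the left only the
  partial Euler product, the term at \<open>s = 0\<close>, contributes. On the right at most one monomial
  contributes, by injectivity, and its coefficient is a sign.
\<close>
lemma card_distinct_partitions_cong:
  "[int (card (distinct_partitions n)) = (if n \<in> range pentagonal then 1 else 0)] (mod 2)"
proof -
  let ?X = "fps_X :: int fps"
  have tail: "fps_nth (shanks_term ?X n s) n = 0" if "s > 0" for s
  proof -
    from that obtain t where "s = Suc t"
      by (cases s) auto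
    then have "n < s * n + triangle s"
      by simp
    then show ?thesis
      by (simp add: shanks_term_def fps_X_power_mult_right_nth)
  qed
  have "fps_nth (\<Prod>k\<in>{0<..n}. 1 - ?X ^ k) n = fps_nth (shanks_term ?X n 0) n"
    by (simp add: shanks_term_def)
  also have "\<dots> = (\<Sum>s\<le>n. fps_nth (shanks_term ?X n s) n)"
    by (subst sum.remove[of _ 0]) (auto simp: tail)
  also have "\<dots> = fps_nth (\<Sum>k\<in>{- int n..int n}. (-1) ^ nat \<bar>k\<bar> * ?X ^ pentagonal k) n"
    by (simp add: fps_sum_nth flip: shanks_identity)
  also have "\<dots> = (\<Sum>k\<in>{- int n..int n}. (-1) ^ nat \<bar>k\<bar> * (if pentagonal k = n then 1 else 0))"
    by (simp only: fps_sum_nth fps_nth_signed_power)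
  also have "[\<dots> = (if n \<in> range pentagonal then 1 else 0)] (mod 2)"
  proof (cases "n \<in> range pentagonal")
    case True
    then obtain l where l: "n = pentagonal l"
      by blast
    have "(\<Sum>k\<in>{- int n..int n}. (-1) ^ nat \<bar>k\<bar> * (if pentagonal k = n then 1 else 0)) =
      (\<Sum>k\<in>{- int n..int n}. if k = l then (-1) ^ nat \<bar>k\<bar> else 0 :: int)"
      using inj_pentagonal by (intro sum.cong) (auto simp: l inj_def)
    also have "\<dots> = (-1) ^ nat \<bar>l\<bar>"
      using abs_le_pentagonal[of l] l by (simp add: abs_le_iff)
    finally show ?thesis
      using True by (simp add: cong_iff_dvd_diff)
  next
    case False
    then have "(\<Sum>k\<in>{- int n..int n}. (-1) ^ nat \<bar>k\<bar> * (if pentagonal k = n then 1 else 0)) = (0::int)"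
      by (intro sum.neutral) auto
    with False show ?thesis
      by simp
  qed
  finally show ?thesis
    using euler_product_coefficient_cong[of n] by (metis cong_sym cong_trans)
qed

section \<open>The alternating sum of parts\<close>

text \<open>
  The odd parts of a partition of \<open>n\<close> add up to \<open>n\<close> minus the sum of its even parts, so odd parts
  minus even parts is \<open>n\<close> minus twice the sum of the even parts.
\<close>
lemma DSOME_cong: "[DSOME n = int n * int (card (distinct_partitions n))] (mod 2)"
proof -
  have "(\<Sum>p\<in>{p\<in>P. odd p}. int p) = int n - (\<Sum>p\<in>{p\<in>P. even p}. int p)"
    if "P \<in> distinct_partitions n" for P
  proof -
    from that have "finite P" and n: "n = \<Sum>P"
      by (auto simp: distinct_partitions_def)
    have "int n = (\<Sum>p\<in>P. int p)"
      unfolding n by simp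
    also have "P = {p\<in>P. odd p} \<union> {p\<in>P. even p}"
      by auto
    also have "(\<Sum>p\<in>{p\<in>P. odd p} \<union> {p\<in>P. even p}. int p) =
      (\<Sum>p\<in>{p\<in>P. odd p}. int p) + (\<Sum>p\<in>{p\<in>P. even p}. int p)"
      using \<open>finite P\<close> by (intro sum.union_disjoint) auto
    finally show ?thesis
      by simp
  qed
  then have "DSOME n = int n * int (card (distinct_partitions n))
      - 2 * (\<Sum>P\<in>distinct_partitions n. \<Sum>p\<in>{p\<in>P. even p}. int p)"
    by (simp add: DSOME_def sum_subtractf)
  then show ?thesis
    by (simp add: cong_iff_dvd_diff)
qed

theorem theorem4p1:
  fixes n :: nat
  shows "[DSOME n =
           (if \<exists>j::int. int n = 24 * j^2 + 10 * j + 1 \<or> int n = 24 * j^2 + 22 * j + 5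
            then 1 else 0)] (mod 2)"
proof -
  have "[DSOME n = int n * (if n \<in> range pentagonal then 1 else 0)] (mod 2)"
    using DSOME_cong cong_scalar_left[OF card_distinct_partitions_cong] by (rule cong_trans)
  also have "[int n * (if n \<in> range pentagonal then 1 else 0) =
    (if odd n \<and> n \<in> range pentagonal then 1 else 0)] (mod 2)"
    by (auto simp: cong_iff_dvd_diff)
  finally show ?thesis
    unfolding odd_pentagonal_iff .
qed

end
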